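(* For every integer $n\ge 1$, $$ DSOME(n)=\sum_{\substack{j\in\mathbb Z\\ j(3j-1)\le n}}(-1)^j\,SOME\bigl(n-j(3j-1)\bigr)-2\sum_{\substack{j\ge 0\\ j(j+1)/2\le n\\ n\equiv j(j+1)/2\ (\mathrm{mod}\ 2)}}SOME\!\left(\frac{n-j(j+1)/2}{2}\right). $$
   Context: A partition of a positive integer $n$ is a non-increasing finite sequence of positive integers (its parts) with sum $n$. $SOME(n)$ is the sum of all odd parts in all partitions of $n$ minus the sum of all even parts in all partitions of $n$ (parts counted with multiplicity), with $SOME(0)=0$. $DSOME(n)$ is the sum of all odd parts minus the sum of all even parts, taken over all partitions of $n$ into distinct parts. *)

theory Defs
  imports Complex_Main "HOL-Number_Theory.Cong"
begin

definition partitions :: "nat \<Rightarrow> nat list set" where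
  "partitions n = {xs. sorted_wrt (\<ge>) xs \<and> (\<forall>x \<in> set xs. x > 0) \<and> sum_list xs = n}"

definition distinct_partitions :: "nat \<Rightarrow> nat list set" where
  "distinct_partitions n = {xs \<in> partitions n. distinct xs}"

definition odd_parts_sum :: "nat list set \<Rightarrow> nat" where
  "odd_parts_sum P = (\<Sum>xs \<in> P. sum_list (filter odd xs))"

definition even_parts_sum :: "nat list set \<Rightarrow> nat" where
  "even_parts_sum P = (\<Sum>xs \<in> P. sum_list (filter even xs))"

text \<open>\<open>SOME\<close> itself is reserved for Hilbert choice, hence the suffix in the names below.\<close>

definition SOME_parts :: "nat \<Rightarrow> int" where
  "SOME_parts n = int (odd_parts_sum (partitions n)) - int (even_parts_sum (partitions n))"

definition DSOME_parts :: "nat \<Rightarrow> int" where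
  "DSOME_parts n =
     int (odd_parts_sum (distinct_partitions n)) - int (even_parts_sum (distinct_partitions n))"

text \<open>
  All sums involved range over finite sets, so none of them is 0 by convention, and the value
  at 0 (where the empty list is the only partition) is the conventional one.
\<close>

lemma finite_partitions: "finite (partitions n)"
proof (rule finite_subset)
  have len: "length xs \<le> sum_list xs" if "\<forall>x \<in> set xs. x > 0" for xs :: "nat list"
    using that by (induction xs) auto
  show "partitions n \<subseteq> {xs. set xs \<subseteq> {..n} \<and> length xs \<le> n}"
    using len by (auto simp: partitions_def dest: member_le_sum_list)
  show "finite {xs. set xs \<subseteq> {..n} \<and> length xs \<le> n}"
    by (rule finite_lists_length_le) simp
qed

lemma finite_distinct_partitions: "finite (distinct_partitions n)"
  by (simp add: distinct_partitions_def finite_partitions)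

lemma SOME_parts_0: "SOME_parts 0 = 0"
proof -
  have "partitions 0 = {[]}"
    by (auto simp: partitions_def) (metis list.set_intros(1) list.exhaust less_irrefl)
  then show ?thesis
    by (simp add: SOME_parts_def odd_parts_sum_def even_parts_sum_def)
qed

lemma finite_pentagonal_indices: "finite {j :: int. j * (3 * j - 1) \<le> int n}"
proof (rule finite_subset)
  show "{j :: int. j * (3 * j - 1) \<le> int n} \<subseteq> {- int n..int n}"
  proof
    fix j :: int
    assume "j \<in> {j. j * (3 * j - 1) \<le> int n}"
    then have le: "j * (3 * j - 1) \<le> int n" by simp
    have "\<bar>j\<bar> * 1 \<le> \<bar>j\<bar> * \<bar>3 * j - 1\<bar>"
      by (rule mult_left_mono) (presburger, simp)
    also have "\<dots> = j * (3 * j - 1)"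
      by (cases "j \<ge> 1") (auto simp: abs_if algebra_simps)
    finally show "j \<in> {- int n..int n}" using le by auto
  qed
qed simp

lemma finite_triangular_indices:
  "finite {j :: nat. j * (j + 1) div 2 \<le> n \<and> [n = j * (j + 1) div 2] (mod 2)}"
proof (rule finite_subset)
  show "{j. j * (j + 1) div 2 \<le> n \<and> [n = j * (j + 1) div 2] (mod 2)} \<subseteq> {..n}"
  proof
    fix j
    assume "j \<in> {j. j * (j + 1) div 2 \<le> n \<and> [n = j * (j + 1) div 2] (mod 2)}"
    then have le: "j * (j + 1) div 2 \<le> n" by simp
    have "j * 2 \<le> j * (j + 1)" by (cases j) auto
    then have "j \<le> j * (j + 1) div 2" by linarith
    with le show "j \<in> {..n}" using le_trans by blast
  qed
qed simp

end

theory Submission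
  imports Defs "HOL-Computational_Algebra.Formal_Power_Series"
begin

text \<open>
  Write \<open>E(q) = \<Prod>(1 - q^k)\<close>, \<open>D(q) = \<Prod>(1 + q^k) = E(q^2) / E(q)\<close> and \<open>L(q) = \<Sum>\<plusminus>k q^k / (1 - q^k)\<close> with
  sign \<open>+\<close> for odd \<open>k\<close>. The generating functions are \<open>S(q) = L(q) / E(q)\<close> for all partitions and
  \<open>D(q) \<cdot> \<Sum>\<plusminus>k q^k / (1 + q^k)\<close> for distinct parts. Since
  \<open>q^k / (1 + q^k) = q^k / (1 - q^k) - 2 q^(2k) / (1 - q^(2k))\<close>, the latter equals
  \<open>D(q) (L(q) - 2 L(q^2)) = E(q^2) S(q) - 2 D(q) E(q^2) S(q^2)\<close>. By Euler, \<open>E(q^2)\<close> is the signed sum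
  of the \<open>q^(j(3j-1))\<close>; by Gauss, \<open>D(q) E(q^2)\<close> is the sum of the \<open>q^(j(j+1)/2)\<close>. This is carried out
  with parts at most \<open>m\<close>, where the identity between the generating functions is exact and only
  the theorems of Euler and Gauss need truncation, modulo \<open>q^(m+1)\<close>.
\<close>

section \<open>The finite identities of Shanks\<close>

text \<open>
  In both identities the left-hand sides for \<open>n + 1\<close> and \<open>n\<close> differ by a sum over \<open>s\<close> that
  telescopes; the antidifferences are \<open>K\<close> and \<open>H\<close> below. Quotients such as \<open>P_n / P_s\<close> in Shanks's
  formulation are multiplied out, so that no inverses are needed.
\<close>

lemma pentagonal_finite:
  fixes q :: "'a::comm_ring_1"
  shows "(\<Sum>s\<le>n. (-1) ^ s * (\<Prod>k=Suc s..n. 1 - q ^ (2 * k)) * q ^ (2 * s * n + s * (s + 1))) =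
    (\<Sum>j=-int n..int n. (-1) ^ nat \<bar>j\<bar> * q ^ nat (j * (3 * j - 1)))"
proof (induction n)
  case 0
  then show ?case by simp
next
  case (Suc n)
  define v where "v m s = (-1) ^ s * (\<Prod>k=Suc s..m. 1 - q ^ (2 * k)) * q ^ (2 * s * m + s * (s + 1))"
    for m s
  \<comment> \<open>For s \<le> n, \<open>K s\<close> equals
    \<open>(1 - q ^ (2 * s)) * v n s\<close>. The extra factor makes \<open>K 0\<close> vanish,
    while in \<open>K (Suc n)\<close> the product is empty and only a signed power of
    \<open>q\<close> remains.\<close>
  define K where "K s = (-1) ^ s * (\<Prod>k=s..n. 1 - q ^ (2 * k)) * q ^ (2 * s * n + s * (s + 1))" for s
  have step: "v (Suc n) s - v n s = K (Suc s) - K s" if "s \<le> n" for s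
  proof -
    define p where "p = (\<Prod>k=Suc s..n. 1 - q ^ (2 * k))"
    define c where "c = q ^ (2 * s * n + s * (s + 1))"
    have 1: "v (Suc n) s = (-1) ^ s * (p * (1 - q ^ (2 * Suc n))) * (c * q ^ (2 * s))"
    proof -
      have "2 * s * Suc n + s * (s + 1) = 2 * s * n + s * (s + 1) + 2 * s" by simp
      then show ?thesis using that by (simp only: v_def p_def c_def power_add) (simp add: mult_ac)
    qed
    have 2: "v n s = (-1) ^ s * p * c"
      by (simp add: v_def p_def c_def)
    have 3: "K s = (-1) ^ s * ((1 - q ^ (2 * s)) * p) * c"
      using that by (simp add: K_def p_def c_def prod.atLeast_Suc_atMost)
    have 4: "K (Suc s) = - ((-1) ^ s) * p * (c * (q ^ (2 * Suc n) * q ^ (2 * s)))"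
    proof -
      have "2 * Suc s * n + Suc s * (Suc s + 1) = 2 * s * n + s * (s + 1) + (2 * Suc n + 2 * s)"
        by simp
      then show ?thesis by (simp only: K_def p_def c_def power_add) (simp add: mult_ac)
    qed
    show ?thesis unfolding 1 2 3 4 by (simp add: algebra_simps)
  qed
  have K0: "K 0 = 0"
    by (simp add: K_def prod.atLeast_Suc_atMost)
  have "(\<Sum>s\<le>n. v (Suc n) s) - (\<Sum>s\<le>n. v n s) = (\<Sum>s<Suc n. K (Suc s) - K s)"
    using step by (simp add: sum_subtractf [symmetric] lessThan_Suc_atMost del: sum.lessThan_Suc)
  also have "\<dots> = K (Suc n)"
    by (subst sum_lessThan_telescope) (simp add: K0)
  finally have *: "(\<Sum>s\<le>Suc n. v (Suc n) s) = (\<Sum>s\<le>n. v n s) + K (Suc n) + v (Suc n) (Suc n)"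
    by (simp add: algebra_simps)
  define g where "g j = (-1) ^ nat \<bar>j\<bar> * q ^ nat (j * (3 * j - 1))" for j :: int
  define N where "N = int (Suc n)"
  have N: "nat \<bar>N\<bar> = Suc n" "nat \<bar>- N\<bar> = Suc n"
    by (simp_all add: N_def)
  \<comment> \<open>The two new indices: \<open>K (Suc n)\<close> supplies j = N and
    \<open>v (Suc n) (Suc n)\<close> supplies j = -N.\<close>
  have "{-N..N} = insert N (insert (-N) {-int n..int n})"
    by (auto simp: N_def)
  then have "(\<Sum>j=-N..N. g j) = g N + (g (-N) + (\<Sum>j=-int n..int n. g j))"
    by (simp add: N_def)
  moreover have "nat (N * (3 * N - 1)) = 2 * Suc n * n + Suc n * (Suc n + 1)"
    by (rule nat_eq_iff [THEN iffD2]) (simp add: N_def algebra_simps)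
  then have "K (Suc n) = g N"
    by (simp add: K_def g_def N)
  moreover have "nat (-N * (3 * (-N) - 1)) = 2 * Suc n * Suc n + Suc n * (Suc n + 1)"
    by (rule nat_eq_iff [THEN iffD2]) (simp add: N_def algebra_simps)
  then have "v (Suc n) (Suc n) = g (-N)"
    unfolding v_def g_def N by simp
  moreover have "(\<Sum>s\<le>n. v n s) = (\<Sum>j=-int n..int n. g j)"
    unfolding v_def g_def by (rule Suc.IH)
  ultimately have "(\<Sum>s\<le>Suc n. v (Suc n) s) = (\<Sum>j=-N..N. g j)"
    using * by (simp only: add_ac)
  then show ?case
    by (simp only: v_def g_def N_def)
qed

lemma triangular_finite:
  fixes q :: "'a::comm_ring_1"
  shows "(\<Sum>s<n. (\<Prod>k=Suc s..n. 1 - q ^ (2 * k)) * (\<Prod>k<s. 1 - q ^ (2 * k + 1)) * q ^ (s * (2 * n + 1))) =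
    (\<Prod>k<n. 1 - q ^ (2 * k + 1)) * (\<Sum>j<2 * n. q ^ (j * (j + 1) div 2))"
proof (induction n)
  case 0
  then show ?case by simp
next
  case (Suc n)
  define B where "B s = (\<Prod>k<s. 1 - q ^ (2 * k + 1))" for s
  define u where "u m s = (\<Prod>k=Suc s..m. 1 - q ^ (2 * k)) * B s * q ^ (s * (2 * m + 1))" for m s
  define H where "H s = (\<Prod>k=s..n. 1 - q ^ (2 * k)) * B s * q ^ (s * (2 * n + 1))" for s
  \<comment> \<open>The old sum is scaled by the factor that turns \<open>B n\<close> into
    \<open>B (Suc n)\<close> on the right-hand side.\<close>
  have step: "u (Suc n) s - (1 - q ^ (2 * n + 1)) * u n s = H (Suc s) - H s" if "s \<le> n" for s
  proof -
    define p where "p = (\<Prod>k=Suc s..n. 1 - q ^ (2 * k)) * B s"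
    define c where "c = q ^ (s * (2 * n + 1))"
    have 1: "u (Suc n) s = p * (1 - q * q ^ (2 * n + 1)) * (c * q ^ (2 * s))"
    proof -
      have "s * (2 * Suc n + 1) = s * (2 * n + 1) + 2 * s" by simp
      then show ?thesis using that by (simp only: u_def p_def c_def power_add) (simp add: mult_ac)
    qed
    have 2: "u n s = p * c"
      by (simp add: u_def p_def c_def)
    have 3: "H s = (1 - q ^ (2 * s)) * p * c"
      using that by (simp add: H_def p_def c_def prod.atLeast_Suc_atMost)
    have 4: "H (Suc s) = p * (1 - q * q ^ (2 * s)) * (c * q ^ (2 * n + 1))"
    proof -
      have "Suc s * (2 * n + 1) = s * (2 * n + 1) + (2 * n + 1)" by simp
      then show ?thesis by (simp only: H_def p_def c_def B_def power_add) (simp add: mult_ac)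
    qed
    show ?thesis unfolding 1 2 3 4 by (simp only: algebra_simps mult_1_left mult_1_right)
  qed
  have H0: "H 0 = 0"
    by (simp add: H_def prod.atLeast_Suc_atMost)
  have "(\<Sum>s<Suc n. u (Suc n) s) - (1 - q ^ (2 * n + 1)) * (\<Sum>s<Suc n. u n s) =
      (\<Sum>s<Suc n. H (Suc s) - H s)"
    using step by (simp add: sum_distrib_left sum_subtractf [symmetric] del: sum.lessThan_Suc)
  also have "\<dots> = H (Suc n)"
    by (subst sum_lessThan_telescope) (simp add: H0)
  \<comment> \<open>The telescoping range includes s = n, which the sum for n lacks; hence the extra
    \<open>u n n\<close>. It and \<open>H (Suc n)\<close> yield the triangular numbers of index 2n
    and 2n + 1.\<close>
  finally have *: "(\<Sum>s<Suc n. u (Suc n) s) =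
      (1 - q ^ (2 * n + 1)) * ((\<Sum>s<n. u n s) + u n n) + H (Suc n)"
    by (simp add: algebra_simps)
  have "2 * n * (2 * n + 1) div 2 = n * (2 * n + 1)"
    by (simp only: mult.assoc nonzero_mult_div_cancel_left)
  then have e1: "u n n = B n * q ^ (2 * n * (2 * n + 1) div 2)"
    by (simp only: u_def) simp
  have "(2 * n + 1) * (2 * n + 2) div 2 = Suc n * (2 * n + 1)"
  proof -
    have "(2 * n + 1) * (2 * n + 2) = 2 * (Suc n * (2 * n + 1))"
      by (simp add: algebra_simps)
    then show ?thesis by simp
  qed
  then have e2: "H (Suc n) = (1 - q ^ (2 * n + 1)) * B n * q ^ ((2 * n + 1) * (2 * n + 2) div 2)"
    by (simp only: H_def B_def prod.lessThan_Suc) (simp add: ac_simps)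
  have IH: "(\<Sum>s<n. u n s) = B n * (\<Sum>j<2 * n. q ^ (j * (j + 1) div 2))"
    using Suc.IH by (simp add: u_def B_def)
  have S: "(\<Sum>j<2 * Suc n. q ^ (j * (j + 1) div 2)) = (\<Sum>j<2 * n. q ^ (j * (j + 1) div 2))
     + q ^ (2 * n * (2 * n + 1) div 2) + q ^ ((2 * n + 1) * (2 * n + 2) div 2)"
    by (simp add: add_ac)
  have "(\<Sum>s<Suc n. u (Suc n) s) = (1 - q ^ (2 * n + 1)) * B n * (\<Sum>j<2 * Suc n. q ^ (j * (j + 1) div 2))"
    unfolding * IH S e1 e2 by (simp only: algebra_simps mult_1_left mult_1_right)
  moreover have "(1 - q ^ (2 * n + 1)) * B n = B (Suc n)"
    by (simp add: B_def mult.commute)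
  ultimately show ?case
    by (simp only: u_def B_def)
qed

section \<open>Generating functions by largest part\<close>

definition signed_sum :: "nat list \<Rightarrow> int" where
  "signed_sum xs = (\<Sum>x\<leftarrow>xs. if odd x then int x else - int x)"

lemma signed_sum_Cons [simp]:
  "signed_sum (x # xs) = (if odd x then int x else - int x) + signed_sum xs"
  by (simp add: signed_sum_def)

lemma signed_sum_filter:
  "signed_sum xs = int (sum_list (filter odd xs)) - int (sum_list (filter even xs))"
  by (induction xs) (auto simp: signed_sum_def)

lemma SOME_parts_eq: "SOME_parts n = (\<Sum>xs\<in>partitions n. signed_sum xs)"
  by (simp add: SOME_parts_def odd_parts_sum_def even_parts_sum_def signed_sum_filter sum_subtractf)

lemma DSOME_parts_eq: "DSOME_parts n = (\<Sum>xs\<in>distinct_partitions n. signed_sum xs)"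
  by (simp add: DSOME_parts_def odd_parts_sum_def even_parts_sum_def signed_sum_filter sum_subtractf)

definition gen_fun :: "('a \<Rightarrow> int) \<Rightarrow> (nat \<Rightarrow> 'a set) \<Rightarrow> int fps" where
  "gen_fun f A = Abs_fps (\<lambda>n. \<Sum>x\<in>A n. f x)"

lemma gen_fun_nth [simp]: "fps_nth (gen_fun f A) n = (\<Sum>x\<in>A n. f x)"
  by (simp add: gen_fun_def)

text \<open>Prepending \<open>k\<close> raises the sum by \<open>k\<close>, hence the power of X.
  The family of tails stays a parameter: it will be \<open>A'\<close> when the part \<open>k\<close>
  may repeat and \<open>A\<close> when parts are distinct.\<close>

lemma gen_fun_add_Cons:
  assumes A': "\<And>n. A' n = A n \<union> (if k \<le> n then Cons k ` A'' (n - k) else {})"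
    and fin: "\<And>n. finite (A n)" "\<And>n. finite (A'' n)"
    and disj: "\<And>n xs. k # xs \<notin> A n"
  shows "gen_fun f A' = gen_fun f A + fps_X ^ k * gen_fun (\<lambda>xs. f (k # xs)) A''"
proof (rule fps_ext)
  fix n
  show "fps_nth (gen_fun f A') n = fps_nth (gen_fun f A + fps_X ^ k * gen_fun (\<lambda>xs. f (k # xs)) A'') n"
  proof (cases "k \<le> n")
    case True
    have "(\<Sum>x\<in>A' n. f x) = (\<Sum>x\<in>A n. f x) + (\<Sum>x\<in>Cons k ` A'' (n - k). f x)"
      unfolding A' using True disj by (simp add: fin) (rule sum.union_disjoint, auto simp: fin)
    with True show ?thesis
      by (simp add: fps_X_power_mult_nth sum.reindex)
  next
    case False
    then show ?thesis by (simp add: fps_X_power_mult_nth A')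
  qed
qed

section \<open>Partitions with bounded parts\<close>

definition parts_le :: "nat \<Rightarrow> nat \<Rightarrow> nat list set" where
  "parts_le m n = {xs \<in> partitions n. set xs \<subseteq> {..m}}"

definition distinct_parts_le :: "nat \<Rightarrow> nat \<Rightarrow> nat list set" where
  "distinct_parts_le m n = {xs \<in> distinct_partitions n. set xs \<subseteq> {..m}}"

lemma finite_parts_le: "finite (parts_le m n)" "finite (distinct_parts_le m n)"
  by (simp_all add: parts_le_def distinct_parts_le_def finite_partitions finite_distinct_partitions)

lemma partitions_subset_atMost: "xs \<in> partitions n \<Longrightarrow> set xs \<subseteq> {..n}"
  by (auto simp: partitions_def dest: member_le_sum_list)

text \<open>With this, the coefficients up to X^m of the bounded series are those for all
  partitions.\<close>

lemma parts_le_ge: "n \<le> m \<Longrightarrow> parts_le m n = partitions n"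
  using partitions_subset_atMost by (fastforce simp: parts_le_def)

lemma distinct_parts_le_ge: "n \<le> m \<Longrightarrow> distinct_parts_le m n = distinct_partitions n"
  using partitions_subset_atMost by (fastforce simp: distinct_parts_le_def distinct_partitions_def)

lemma parts_le_0:
  "parts_le 0 n = (if n = 0 then {[]} else {})"
  "distinct_parts_le 0 n = (if n = 0 then {[]} else {})"
proof -
  have "xs = []" if "xs \<in> parts_le 0 n" for xs
    using that by (cases xs) (auto simp: parts_le_def partitions_def)
  moreover have "[] \<in> parts_le 0 n \<longleftrightarrow> n = 0"
    by (auto simp: parts_le_def partitions_def)
  ultimately show "parts_le 0 n = (if n = 0 then {[]} else {})"
    by auto
  moreover have "distinct_parts_le 0 n = {xs \<in> parts_le 0 n. distinct xs}"
    by (auto simp: distinct_parts_le_def distinct_partitions_def parts_le_def)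
  ultimately show "distinct_parts_le 0 n = (if n = 0 then {[]} else {})"
    by auto
qed

lemma Cons_Suc_mem_parts_le:
  "Suc m # xs \<in> parts_le (Suc m) n \<longleftrightarrow> Suc m \<le> n \<and> xs \<in> parts_le (Suc m) (n - Suc m)"
  by (auto simp: parts_le_def partitions_def)

text \<open>Distinctness forbids a second \<open>Suc m\<close>, so the bound on the tail drops to
  \<open>m\<close>.\<close>

lemma Cons_Suc_mem_distinct_parts_le:
  "Suc m # xs \<in> distinct_parts_le (Suc m) n \<longleftrightarrow>
     Suc m \<le> n \<and> xs \<in> distinct_parts_le m (n - Suc m)"
  by (auto simp: distinct_parts_le_def distinct_partitions_def partitions_def le_Suc_eq subset_iff)

text \<open>The list is non-increasing, so if \<open>Suc m\<close> occurs at all, it is the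
  head.\<close>

lemma mem_parts_le_cases:
  assumes "xs \<in> parts_le (Suc m) n"
  shows "xs \<in> parts_le m n \<or> (\<exists>ys. xs = Suc m # ys)"
  using assms
  by (cases xs) (fastforce simp: parts_le_def partitions_def le_Suc_eq)+

lemma distinct_parts_le_alt: "distinct_parts_le m n = {xs \<in> parts_le m n. distinct xs}"
  by (auto simp: distinct_parts_le_def distinct_partitions_def parts_le_def)

lemma parts_le_Suc:
  "parts_le (Suc m) n =
     parts_le m n \<union> (if Suc m \<le> n then Cons (Suc m) ` parts_le (Suc m) (n - Suc m) else {})"
proof -
  have "parts_le m n \<subseteq> parts_le (Suc m) n"
    by (auto simp: parts_le_def)
  then show ?thesis
    using mem_parts_le_cases Cons_Suc_mem_parts_le by (auto split: if_splits) blast+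
qed

lemma distinct_parts_le_Suc:
  "distinct_parts_le (Suc m) n =
     distinct_parts_le m n \<union>
       (if Suc m \<le> n then Cons (Suc m) ` distinct_parts_le m (n - Suc m) else {})"
proof -
  have "distinct_parts_le m n \<subseteq> distinct_parts_le (Suc m) n"
    by (auto simp: distinct_parts_le_def)
  moreover have "xs \<in> distinct_parts_le m n \<or> (\<exists>ys. xs = Suc m # ys)"
    if "xs \<in> distinct_parts_le (Suc m) n" for xs
    using that mem_parts_le_cases unfolding distinct_parts_le_alt by blast
  ultimately show ?thesis
    using Cons_Suc_mem_distinct_parts_le by (auto split: if_splits) blast+
qed

lemma Cons_Suc_notin_parts_le:
  "Suc m # xs \<notin> parts_le m n" "Suc m # xs \<notin> distinct_parts_le m n"
  by (auto simp: parts_le_def distinct_parts_le_def)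

lemmas gen_fun_parts_le_Suc =
  gen_fun_add_Cons [OF parts_le_Suc finite_parts_le(1) finite_parts_le(1) Cons_Suc_notin_parts_le(1)]

lemmas gen_fun_distinct_parts_le_Suc =
  gen_fun_add_Cons [OF distinct_parts_le_Suc finite_parts_le(2) finite_parts_le(2)
    Cons_Suc_notin_parts_le(2)]

lemma gen_fun_add: "gen_fun (\<lambda>x. f x + g x) A = gen_fun f A + gen_fun g A"
  by (rule fps_ext) (simp add: sum.distrib)

lemma gen_fun_const: "gen_fun (\<lambda>x. c) A = of_int c * gen_fun (\<lambda>_. 1) A"
  by (rule fps_ext) (simp add: fps_of_int [symmetric])

definition part_count :: "nat \<Rightarrow> int fps" where
  "part_count m = gen_fun (\<lambda>_. 1) (parts_le m)"

definition distinct_part_count :: "nat \<Rightarrow> int fps" where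
  "distinct_part_count m = gen_fun (\<lambda>_. 1) (distinct_parts_le m)"

definition part_weight :: "nat \<Rightarrow> int fps" where
  "part_weight m = gen_fun signed_sum (parts_le m)"

definition distinct_part_weight :: "nat \<Rightarrow> int fps" where
  "distinct_part_weight m = gen_fun signed_sum (distinct_parts_le m)"

lemma gen_fun_0:
  "part_count 0 = 1" "distinct_part_count 0 = 1" "part_weight 0 = 0" "distinct_part_weight 0 = 0"
  by (rule fps_ext; simp add: part_count_def distinct_part_count_def part_weight_def
    distinct_part_weight_def parts_le_0 signed_sum_def)+

abbreviation signed_int :: "nat \<Rightarrow> int" where
  "signed_int k \<equiv> if odd k then int k else - int k"

text \<open>The largest part may repeat, so the series recurs on the right. The equation is used in
  the form \<open>(1 - fps_X ^ Suc m) * part_count (Suc m) = part_count m\<close>.\<close>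

lemma part_count_Suc:
  "part_count (Suc m) = part_count m + fps_X ^ Suc m * part_count (Suc m)"
  unfolding part_count_def by (rule gen_fun_parts_le_Suc)

lemma distinct_part_count_Suc:
  "distinct_part_count (Suc m) = (1 + fps_X ^ Suc m) * distinct_part_count m"
  unfolding distinct_part_count_def by (subst gen_fun_distinct_parts_le_Suc) (simp add: algebra_simps)

text \<open>Each tail contributes its own weight and, once, the signed value of the new head; the
  latter sums to a multiple of the count.\<close>

lemma part_weight_Suc:
  "part_weight (Suc m) = part_weight m + fps_X ^ Suc m *
     (of_int (signed_int (Suc m)) * part_count (Suc m) + part_weight (Suc m))"
  unfolding part_count_def part_weight_def
  by (subst gen_fun_parts_le_Suc) (simp only: signed_sum_Cons gen_fun_add gen_fun_const [symmetric])

lemma distinct_part_weight_Suc: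
  "distinct_part_weight (Suc m) = distinct_part_weight m + fps_X ^ Suc m *
     (of_int (signed_int (Suc m)) * distinct_part_count m + distinct_part_weight m)"
  unfolding distinct_part_count_def distinct_part_weight_def
  by (subst gen_fun_distinct_parts_le_Suc)
    (simp only: signed_sum_Cons gen_fun_add gen_fun_const [symmetric])

section \<open>The relation between the generating functions\<close>

definition euler_prod :: "nat \<Rightarrow> int fps" where
  "euler_prod m = (\<Prod>k=1..m. 1 - fps_X ^ k)"

lemma euler_prod_Suc: "euler_prod (Suc m) = (1 - fps_X ^ Suc m) * euler_prod m"
  by (simp add: euler_prod_def mult.commute)

text \<open>This provides inverses of Euler products inside the integer power series.\<close>

lemma euler_prod_part_count: "euler_prod m * part_count m = 1"
proof (induction m)
  case 0
  then show ?case by (simp add: euler_prod_def gen_fun_0)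
next
  case (Suc m)
  have "(1 - fps_X ^ Suc m) * part_count (Suc m) = part_count m"
    using part_count_Suc [of m] by (simp only: algebra_simps mult_1_left mult_1_right)
  then show ?case
    using Suc by (simp only: euler_prod_Suc ac_simps)
qed

section \<open>Substitution of q^2 for q\<close>

abbreviation dilate :: "int fps \<Rightarrow> int fps" where
  "dilate F \<equiv> fps_compose F (fps_X ^ 2)"

lemma dilate_mult: "dilate (F * G) = dilate F * dilate G"
  by (rule fps_compose_mult_distrib) simp

lemma dilate_nth: "fps_nth (dilate F) n = (if even n then fps_nth F (n div 2) else 0)"
proof -
  have "fps_nth (dilate F) n = (\<Sum>i=0..n. if i = n div 2 \<and> even n then fps_nth F i else 0)"
    unfolding fps_compose_nth power_mult [symmetric] fps_X_power_nth
    by (rule sum.cong) auto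
  then show ?thesis
    by (cases "even n") (simp_all add: sum.delta)
qed

text \<open>The product form lets a power of X be abbreviated by \<open>q\<close> with
  \<open>dilate q = q * q\<close>, so that later steps are ring identities in
  \<open>q\<close>.\<close>

lemma dilate_X_power: "dilate (fps_X ^ k) = fps_X ^ k * fps_X ^ k"
  by (simp add: fps_compose_power [symmetric] power_mult [symmetric] power_add [symmetric] mult_2)

lemma dilate_of_int: "dilate (of_int c) = of_int c"
  by (simp add: fps_of_int [symmetric])

lemmas dilate_simps = dilate_mult dilate_X_power dilate_of_int fps_compose_add_distrib
  fps_compose_sub_distrib fps_compose_1

text \<open>Factor by factor, this is (1 + q)(1 - q) = 1 - q^2 for q = X^k.\<close>

lemma distinct_part_count_euler_prod:
  "distinct_part_count m * euler_prod m = dilate (euler_prod m)"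
proof (induction m)
  case 0
  then show ?case by (simp add: euler_prod_def gen_fun_0)
next
  case (Suc m)
  then show ?case
    by (simp only: distinct_part_count_Suc euler_prod_Suc dilate_simps Suc.IH [symmetric])
      (simp only: algebra_simps mult_1_left mult_1_right)
qed

lemma distinct_part_weight_eq:
  "distinct_part_weight m = dilate (euler_prod m) * part_weight m
     - 2 * (distinct_part_count m * dilate (euler_prod m)) * dilate (part_weight m)"
proof -
  \<comment> \<open>The bracket is the sum of \<open>signed_int k\<close> times X^k / (1 + X^k) over
    k \<le> m; the induction verifies its increments.\<close>
  have "distinct_part_weight m = distinct_part_count m *
     (euler_prod m * part_weight m - 2 * (dilate (euler_prod m) * dilate (part_weight m)))"
  proof (induction m)
    case 0
    then show ?case by (simp add: gen_fun_0)
  next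
    case (Suc m)
    define c :: "int fps" where "c = of_int (signed_int (Suc m))"
    define q :: "int fps" where "q = fps_X ^ Suc m"
    \<comment> \<open>\<open>x\<close> is 1 / (1 - q) and \<open>dilate x\<close> is 1 / (1 - q^2),
      obtained without division.\<close>
    define x where "x = euler_prod m * part_count (Suc m)"
    have x: "(1 - q) * x = 1"
      using euler_prod_part_count [of "Suc m"] by (simp only: x_def q_def euler_prod_Suc mult.assoc)
    have dq: "dilate q = q * q"
      by (simp only: q_def dilate_X_power)
    have y: "(1 - q * q) * dilate x = 1"
      using arg_cong [OF x, of dilate] by (simp only: dilate_simps dq)
    have xy: "x = (1 + q) * dilate x"
    proof -
      have "x = x * ((1 - q * q) * dilate x)"
        using y by simp
      also have "\<dots> = (1 - q) * x * ((1 + q) * dilate x)"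
        by (simp only: algebra_simps mult_1_left mult_1_right)
      finally show ?thesis using x by simp
    qed
    have "(1 - q) * part_weight (Suc m) = part_weight m + q * c * part_count (Suc m)"
      using part_weight_Suc [of m] unfolding q_def [symmetric] c_def [symmetric]
      by (simp only: algebra_simps mult_1_left mult_1_right)
    then have "euler_prod m * ((1 - q) * part_weight (Suc m)) =
        euler_prod m * (part_weight m + q * c * part_count (Suc m))"
      by simp
    then have w: "euler_prod (Suc m) * part_weight (Suc m) = euler_prod m * part_weight m + q * c * x"
      unfolding x_def euler_prod_Suc q_def [symmetric] by (simp only: algebra_simps mult_1_left mult_1_right)
    have w2: "dilate (euler_prod (Suc m)) * dilate (part_weight (Suc m)) =
        dilate (euler_prod m) * dilate (part_weight m) + q * q * c * dilate x"
      using arg_cong [OF w, of dilate] by (simp only: dilate_simps dq c_def)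
    have "distinct_part_count (Suc m) * (euler_prod (Suc m) * part_weight (Suc m)
        - 2 * (dilate (euler_prod (Suc m)) * dilate (part_weight (Suc m)))) =
        (1 + q) * (distinct_part_count m *
          (euler_prod m * part_weight m - 2 * (dilate (euler_prod m) * dilate (part_weight m))))
        + distinct_part_count m * q * c * ((1 + q) * x - 2 * q * ((1 + q) * dilate x))"
      unfolding w w2 distinct_part_count_Suc q_def [symmetric] by (simp only: algebra_simps mult_1_left mult_1_right)
    \<comment> \<open>By \<open>xy\<close> both products are multiples of \<open>x\<close>. As (1 -
      q) \<open>x\<close> = 1, the increment reduces to the term of the new part in
      \<open>distinct_part_weight_Suc\<close>.\<close>
    also have "(1 + q) * x - 2 * q * ((1 + q) * dilate x) = (1 - q) * x"
      unfolding xy [symmetric] by (simp add: algebra_simps)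
    finally show ?case
      unfolding Suc.IH [symmetric] x distinct_part_weight_Suc q_def [symmetric] c_def [symmetric]
      by (simp add: algebra_simps)
  qed
  then show ?thesis
    unfolding distinct_part_count_euler_prod [symmetric] by (simp only: algebra_simps)
qed

lemma dilate_euler_prod: "dilate (euler_prod m) = (\<Prod>k=1..m. 1 - fps_X ^ (2 * k))"
proof (induction m)
  case 0
  then show ?case by (simp add: euler_prod_def)
next
  case (Suc m)
  then show ?case
    by (simp only: euler_prod_Suc dilate_simps) (simp add: mult.commute flip: power_add mult_2_right)
qed

section \<open>Truncated theorems of Euler and Gauss\<close>

text \<open>The exponents are twice the generalized pentagonal numbers.\<close>

definition pentagonal_sum :: "nat \<Rightarrow> int fps" where
  "pentagonal_sum m = (\<Sum>j=-int m..int m. (-1) ^ nat \<bar>j\<bar> * fps_X ^ nat (j * (3 * j - 1)))"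

definition triangular_sum :: "nat \<Rightarrow> int fps" where
  "triangular_sum m = (\<Sum>j<2 * m. fps_X ^ (j * (j + 1) div 2))"

text \<open>In the finite identity the term s = 0 is the whole product; all others carry an exponent
  above m.\<close>

lemma dilate_euler_prod_pentagonal:
  "fps_X ^ Suc m dvd dilate (euler_prod m) - pentagonal_sum m"
proof -
  let ?v = "\<lambda>s. (-1) ^ s * (\<Prod>k=Suc s..m. 1 - fps_X ^ (2 * k)) * fps_X ^ (2 * s * m + s * (s + 1)) :: int fps"
  have "pentagonal_sum m = (\<Sum>s\<le>m. ?v s)"
    unfolding pentagonal_sum_def by (rule pentagonal_finite [symmetric])
  also have "\<dots> = dilate (euler_prod m) + (\<Sum>s=1..m. ?v s)"
    by (simp add: dilate_euler_prod atMost_atLeast0 sum.atLeast_Suc_atMost)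
  finally have "dilate (euler_prod m) - pentagonal_sum m = - (\<Sum>s=1..m. ?v s)"
    by simp
  moreover have "fps_X ^ Suc m dvd (\<Sum>s=1..m. ?v s)"
  proof (intro dvd_sum dvd_mult le_imp_power_dvd)
    fix s assume "s \<in> {1..m}"
    then obtain t where "s = Suc t" by (cases s) auto
    then show "Suc m \<le> 2 * s * m + s * (s + 1)" by simp
  qed
  ultimately show ?thesis by simp
qed

text \<open>Again the term s = 0 is the product and the others have exponent at least 2m + 1. For m
  = 0 the sum over s < m would lack the term s = 0.\<close>

lemma prod_odd_triangular:
  assumes "m \<ge> 1"
  shows "fps_X ^ Suc m dvd dilate (euler_prod m) - (\<Prod>k<m. 1 - fps_X ^ (2 * k + 1)) * triangular_sum m"
proof -
  obtain l where Suc: "m = Suc l"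
    using assms by (cases m) auto
  let ?u = "\<lambda>s. (\<Prod>k=Suc s..m. 1 - fps_X ^ (2 * k)) * (\<Prod>k<s. 1 - fps_X ^ (2 * k + 1))
    * fps_X ^ (s * (2 * m + 1)) :: int fps"
  have "(\<Prod>k<m. 1 - fps_X ^ (2 * k + 1)) * triangular_sum m = (\<Sum>s<m. ?u s)"
    unfolding triangular_sum_def by (rule triangular_finite [symmetric])
  also have "\<dots> = dilate (euler_prod m) + (\<Sum>s<l. ?u (Suc s))"
    unfolding Suc by (subst sum.lessThan_Suc_shift) (simp add: dilate_euler_prod)
  finally have "dilate (euler_prod m) - (\<Prod>k<m. 1 - fps_X ^ (2 * k + 1)) * triangular_sum m
      = - (\<Sum>s<l. ?u (Suc s))"
    by simp
  moreover have "fps_X ^ Suc m dvd (\<Sum>s<l. ?u (Suc s))"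
    by (intro dvd_sum dvd_mult le_imp_power_dvd) simp
  ultimately show ?thesis by simp
qed

lemma euler_prod_double:
  "euler_prod (2 * m) = dilate (euler_prod m) * (\<Prod>k<m. 1 - fps_X ^ (2 * k + 1))"
  unfolding dilate_euler_prod by (induction m) (simp_all add: euler_prod_def algebra_simps)

text \<open>Every factor beyond the m-th is 1 modulo X^(m+1).\<close>

lemma euler_prod_stable: "fps_X ^ Suc m dvd euler_prod (m + i) - euler_prod m"
proof (induction i)
  case 0
  then show ?case by simp
next
  case (Suc i)
  have "euler_prod (m + Suc i) - euler_prod m =
      (euler_prod (m + i) - euler_prod m) - fps_X ^ Suc (m + i) * euler_prod (m + i)"
    by (simp only: add_Suc_right euler_prod_Suc) (simp only: algebra_simps mult_1_left mult_1_right)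
  moreover have "(fps_X :: int fps) ^ Suc m dvd fps_X ^ Suc (m + i)"
    by (rule le_imp_power_dvd) simp
  ultimately show ?case
    using Suc by (metis dvd_diff dvd_mult2)
qed

text \<open>With \<open>A\<close>, \<open>B\<close>, \<open>D\<close>, \<open>T\<close> as below and
  modulo X^(m+1): \<open>A * B\<close> is \<open>euler_prod (2 * m)\<close>, congruent to
  \<open>euler_prod m\<close>, so \<open>D * A * B\<close> is congruent to
  \<open>D * euler_prod m = A\<close>, hence to \<open>B * T\<close>. Then \<open>B\<close> is
  cancelled.\<close>

lemma distinct_part_count_triangular:
  assumes "m \<ge> 1"
  shows "fps_X ^ Suc m dvd distinct_part_count m * dilate (euler_prod m) - triangular_sum m"
proof -
  define A B where "A = dilate (euler_prod m)" and "B = (\<Prod>k<m. 1 - fps_X ^ (2 * k + 1) :: int fps)"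
  define D T where "D = distinct_part_count m" and "T = triangular_sum m"
  \<comment> \<open>The inverse of \<open>B\<close>, since \<open>A * B\<close> is the Euler product
    up to 2m.\<close>
  define I where "I = A * part_count (2 * m)"
  have BI: "B * I = 1"
    using euler_prod_part_count [of "2 * m"]
    unfolding euler_prod_double A_def [symmetric] B_def [symmetric] I_def by (simp only: mult_ac)
  have "fps_X ^ Suc m dvd A * B - euler_prod m"
    using euler_prod_stable [of m m] by (simp add: A_def B_def euler_prod_double flip: mult_2)
  then have "fps_X ^ Suc m dvd D * (A * B - euler_prod m) + (A - B * T)"
    using prod_odd_triangular [OF assms] by (simp add: A_def B_def T_def)
  also have "\<dots> = B * (D * A - T)"
    using distinct_part_count_euler_prod [of m] by (simp add: A_def D_def algebra_simps)
  finally have "fps_X ^ Suc m dvd I * (B * (D * A - T))"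
    by (rule dvd_mult)
  also have "\<dots> = D * A - T"
    using BI by (simp add: mult_ac flip: mult.assoc)
  finally show ?thesis
    by (simp add: A_def D_def T_def)
qed

section \<open>Extraction of coefficients\<close>

lemma fps_nth_mult_cong_X_power:
  fixes F G :: "'a::comm_ring_1 fps"
  assumes "fps_X ^ Suc m dvd F - G" "n \<le> m"
  shows "fps_nth (F * H) n = fps_nth (G * H) n"
proof -
  obtain R where "F - G = fps_X ^ Suc m * R" using assms(1) by (elim dvdE)
  then have "F * H - G * H = fps_X ^ Suc m * (R * H)"
    by (simp only: left_diff_distrib [symmetric] mult.assoc)
  then have "fps_nth (F * H - G * H) n = 0"
    using assms(2) by (simp only: fps_X_power_mult_nth) simp
  then show ?thesis by simp
qed

lemma part_weight_nth: "n \<le> m \<Longrightarrow> fps_nth (part_weight m) n = SOME_parts n"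
  by (simp add: part_weight_def SOME_parts_eq parts_le_ge)

lemma pentagonal_sum_part_weight_nth:
  "fps_nth (pentagonal_sum n * part_weight n) n =
    (\<Sum>j \<in> {j :: int. j * (3 * j - 1) \<le> int n}.
        (- 1) ^ nat \<bar>j\<bar> * SOME_parts (nat (int n - j * (3 * j - 1))))"
proof -
  \<comment> \<open>This bound serves twice: it justifies \<open>nat\<close> in the exponents, and
    it places every index with j(3j - 1) \<le> n between -n and n.\<close>
  have nonneg: "j * (3 * j - 1) \<ge> \<bar>j\<bar>" for j :: int
  proof -
    have "\<bar>j\<bar> * 1 \<le> \<bar>j\<bar> * \<bar>3 * j - 1\<bar>"
      by (rule mult_left_mono) (presburger, simp)
    also have "\<dots> = j * (3 * j - 1)"
      by (cases "j \<ge> 1") (auto simp: abs_if algebra_simps)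
    finally show ?thesis by simp
  qed
  have coeff: "fps_nth ((-1) ^ nat \<bar>j\<bar> * fps_X ^ nat (j * (3 * j - 1)) * part_weight n) n =
      (if j * (3 * j - 1) \<le> int n
       then (- 1) ^ nat \<bar>j\<bar> * SOME_parts (nat (int n - j * (3 * j - 1))) else 0)" for j
  proof -
    define e where "e = nat (j * (3 * j - 1))"
    have e: "j * (3 * j - 1) = int e"
      using nonneg [of j] by (simp add: e_def)
    have "(-1 :: int fps) ^ nat \<bar>j\<bar> = fps_const ((-1) ^ nat \<bar>j\<bar>)"
      by (simp flip: fps_const_power fps_const_neg)
    then show ?thesis
      unfolding e by (simp add: mult.assoc fps_X_power_mult_nth part_weight_nth nat_diff_distrib)
  qed
  have "fps_nth (pentagonal_sum n * part_weight n) n = (\<Sum>j=-int n..int n. if j * (3 * j - 1) \<le> int n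
       then (- 1) ^ nat \<bar>j\<bar> * SOME_parts (nat (int n - j * (3 * j - 1))) else 0)"
    unfolding pentagonal_sum_def sum_distrib_right fps_sum_nth coeff ..
  also have "\<dots> = (\<Sum>j | j \<in> {-int n..int n} \<and> j * (3 * j - 1) \<le> int n.
       (- 1) ^ nat \<bar>j\<bar> * SOME_parts (nat (int n - j * (3 * j - 1))))"
    by (rule sum.inter_filter [symmetric]) simp
  also have "{j. j \<in> {-int n..int n} \<and> j * (3 * j - 1) \<le> int n} = {j. j * (3 * j - 1) \<le> int n}"
  proof -
    have "j \<in> {-int n..int n}" if "j * (3 * j - 1) \<le> int n" for j
      using order_trans [OF nonneg [of j] that] by simp linarith
    then show ?thesis by blast
  qed
  finally show ?thesis .
qed

lemma triangular_sum_part_weight_nth: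
  assumes "n \<ge> 1"
  shows "fps_nth (triangular_sum n * dilate (part_weight n)) n =
    (\<Sum>j \<in> {j :: nat. j * (j + 1) div 2 \<le> n \<and> [n = j * (j + 1) div 2] (mod 2)}.
        SOME_parts ((n - j * (j + 1) div 2) div 2))"
proof -
  \<comment> \<open>A dilated series has only even exponents; this is the source of the congruence
    and of the halved argument.\<close>
  have coeff: "fps_nth (fps_X ^ e * dilate (part_weight n)) n =
      (if e \<le> n \<and> [n = e] (mod 2) then SOME_parts ((n - e) div 2) else 0)" for e
  proof (cases "e \<le> n")
    case True
    then have "[n = e] (mod 2) \<longleftrightarrow> even (n - e)"
      unfolding cong_def by (rule mod_eq_dvd_iff_nat)
    with True show ?thesis
      by (simp add: fps_X_power_mult_nth dilate_nth part_weight_nth)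
  next
    case False
    then show ?thesis by (simp add: fps_X_power_mult_nth)
  qed
  \<comment> \<open>The truncation at 2n loses no index: j \<le> n < 2n, strictly because n \<ge>
    1.\<close>
  have bound: "j < 2 * n" if "j * (j + 1) div 2 \<le> n" for j
  proof -
    have "j * 2 \<le> j * (j + 1)" by (cases j) auto
    then have "j \<le> j * (j + 1) div 2" by linarith
    with that assms show ?thesis by linarith
  qed
  have "fps_nth (triangular_sum n * dilate (part_weight n)) n = (\<Sum>j<2 * n.
      if j * (j + 1) div 2 \<le> n \<and> [n = j * (j + 1) div 2] (mod 2)
      then SOME_parts ((n - j * (j + 1) div 2) div 2) else 0)"
    unfolding triangular_sum_def sum_distrib_right fps_sum_nth coeff ..
  also have "\<dots> = (\<Sum>j | j \<in> {..<2 * n} \<and> j * (j + 1) div 2 \<le> n \<and> [n = j * (j + 1) div 2] (mod 2).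
      SOME_parts ((n - j * (j + 1) div 2) div 2))"
    by (rule sum.inter_filter [symmetric]) simp
  also have "{j. j \<in> {..<2 * n} \<and> j * (j + 1) div 2 \<le> n \<and> [n = j * (j + 1) div 2] (mod 2)} =
      {j. j * (j + 1) div 2 \<le> n \<and> [n = j * (j + 1) div 2] (mod 2)}"
    using bound by blast
  finally show ?thesis .
qed

theorem theorem3p6:
  fixes n :: nat
  assumes "n \<ge> 1"
  shows "DSOME_parts n =
    (\<Sum>j \<in> {j :: int. j * (3 * j - 1) \<le> int n}.
        (- 1) ^ nat \<bar>j\<bar> * SOME_parts (nat (int n - j * (3 * j - 1))))
    - 2 * (\<Sum>j \<in> {j :: nat. j * (j + 1) div 2 \<le> n \<and> [n = j * (j + 1) div 2] (mod 2)}.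
        SOME_parts ((n - j * (j + 1) div 2) div 2))"
proof -
  \<comment> \<open>Taking m = n suffices: the coefficient of X^n survives reduction modulo
    X^(n+1).\<close>
  have "DSOME_parts n = fps_nth (distinct_part_weight n) n"
    by (simp add: distinct_part_weight_def DSOME_parts_eq distinct_parts_le_ge)
  also have "\<dots> = fps_nth (dilate (euler_prod n) * part_weight n) n
      - 2 * fps_nth (distinct_part_count n * dilate (euler_prod n) * dilate (part_weight n)) n"
    unfolding distinct_part_weight_eq mult.assoc by (simp add: numeral_fps_const)
  also have "fps_nth (dilate (euler_prod n) * part_weight n) n =
      fps_nth (pentagonal_sum n * part_weight n) n"
    by (rule fps_nth_mult_cong_X_power [OF dilate_euler_prod_pentagonal]) simp
  also have "fps_nth (distinct_part_count n * dilate (euler_prod n) * dilate (part_weight n)) n =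
      fps_nth (triangular_sum n * dilate (part_weight n)) n"
    by (rule fps_nth_mult_cong_X_power [OF distinct_part_count_triangular [OF assms]]) simp
  finally show ?thesis
    by (simp only: pentagonal_sum_part_weight_nth triangular_sum_part_weight_nth [OF assms])
qed

end
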